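(* Let $k$ be even, let $W_+\in\mathbb{C}^{n\times k/2}$, $W_-=K\overline{W}_+$, and let $W=[W_+,W_-]\in\mathbb{C}^{n\times k}$ have full column rank. Let $W=QR$ with $Q\in\mathbb{C}^{n\times k}$ having orthonormal columns and $R\in\mathbb{C}^{k\times k}$ invertible, and assume that $Q^*SQ$ is invertible. Let $G=(Q^*SQ)^{-1}Q^*SHQ$. Let $Z_+$ and $Z_-$ be the right eigenvectors of $G$ associated with its positive and negative eigenvalues, collected in the diagonal matrices $\tilde\Lambda_+$ and $\tilde\Lambda_-$ respectively (so $GZ_\pm=Z_\pm\tilde\Lambda_\pm$). Then the spectrum of $G$ is real and positive-negative symmetric, i.e. (with matching ordering) $$\tilde\Lambda_-=-\tilde\Lambda_+,$$ and the associated back-transformed approximate eigenvectors satisfy (with $Z_-$ correspondingly chosen) $$QZ_-=K\,\overline{QZ_+}.$$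
   Context: Let $m\ge1$, $n=2m$, and let $A,B\in\mathbb{C}^{m\times m}$ with $A=A^*$ and $B=B^T$. A bar denotes entrywise complex conjugation and $^*$ the conjugate transpose. Define $$H=\begin{bmatrix}A&B\\-\bar B&-\bar A\end{bmatrix},\quad S=\begin{bmatrix}I_m&0\\0&-I_m\end{bmatrix},\quad K=\begin{bmatrix}0&I_m\\ I_m&0\end{bmatrix}.$$ Standing assumption: $SH=\begin{bmatrix}A&B\\\bar B&\bar A\end{bmatrix}$ is hermitian positive definite. The matrix $G$ is the oblique Rayleigh quotient $G=Q_{\mathcal L}^*HQ$ with dual basis $Q_{\mathcal L}=SQ(Q^*SQ)^{-1}$, which satisfies $Q_{\mathcal L}^*Q=I_k$. "With $Z_-$ correspondingly chosen" means: given $Z_+$ with $GZ_+=Z_+\tilde\Lambda_+$, the eigenvectors $Z_-$ for $-\tilde\Lambda_+$ are ordered and normalized (eigenvectors being determined only up to scaling and choice of basis of the eigenspaces) so that the relation holds. *)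

theory Defs
  imports
    "Jordan_Normal_Form.Spectral_Radius"
    "Jordan_Normal_Form.Schur_Decomposition"
    "Jordan_Normal_Form.DL_Rank"
    "Jordan_Normal_Form.Gauss_Jordan_Elimination"
begin

abbreviation cnj_mat :: "complex mat \<Rightarrow> complex mat" where
  "cnj_mat M \<equiv> map_mat cnj M"

definition H_mat :: "complex mat \<Rightarrow> complex mat \<Rightarrow> complex mat" where
  "H_mat A B = four_block_mat A B (- cnj_mat B) (- cnj_mat A)"

definition S_mat :: "nat \<Rightarrow> complex mat" where
  "S_mat m = four_block_mat (1\<^sub>m m) (0\<^sub>m m m) (0\<^sub>m m m) (- 1\<^sub>m m)"

definition K_mat :: "nat \<Rightarrow> complex mat" where
  "K_mat m = four_block_mat (0\<^sub>m m m) (1\<^sub>m m) (1\<^sub>m m) (0\<^sub>m m m)"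

definition hermitian_pos_def :: "complex mat \<Rightarrow> bool" where
  "hermitian_pos_def M \<longleftrightarrow> square_mat M \<and> mat_adjoint M = M \<and>
     (\<forall>v \<in> carrier_vec (dim_row M). v \<noteq> 0\<^sub>v (dim_row M) \<longrightarrow> Re ((M *\<^sub>v v) \<bullet>c v) > 0)"

definition append_cols :: "complex mat \<Rightarrow> complex mat \<Rightarrow> complex mat" where
  "append_cols X Y = mat_of_cols (dim_row X) (cols X @ cols Y)"

definition full_column_rank :: "complex mat \<Rightarrow> bool" where
  "full_column_rank M \<longleftrightarrow> vec_space.rank (dim_row M) M = dim_col M"

(* mat_inverse is option-valued; the value of "the" is meaningful when Q^* S Q is invertible,
   which is assumed wherever G_mat is used. *)
definition G_mat :: "nat \<Rightarrow> complex mat \<Rightarrow> complex mat \<Rightarrow> complex mat \<Rightarrow> complex mat" where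
  "G_mat m A B Q =
     the (mat_inverse (mat_adjoint Q * S_mat m * Q)) * (mat_adjoint Q * S_mat m * H_mat A B * Q)"

(* "Z collects the right eigenvectors of G associated with its eigenvalues in E, and the diagonal
   matrix L the eigenvalues".  The columns of Z are a maximal independent family of such
   eigenvectors: they are linearly independent, and each eigenvector of G for an eigenvalue in E
   is a combination of them.  The number of columns is not prescribed. *)
definition eigenvector_matrix ::
    "complex mat \<Rightarrow> complex set \<Rightarrow> complex mat \<Rightarrow> complex mat \<Rightarrow> bool" where
  "eigenvector_matrix G E Z L \<longleftrightarrow>
     Z \<in> carrier_mat (dim_row G) (dim_row L) \<and> square_mat L \<and> diagonal_mat L \<and>
     (\<forall>i < dim_row L. L $$ (i, i) \<in> E) \<and>
     G * Z = Z * L \<and>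
     full_column_rank Z \<and>
     (\<forall>\<mu> \<in> E. \<forall>v. eigenvector G v \<mu> \<longrightarrow> (\<exists>c \<in> carrier_vec (dim_col Z). v = Z *\<^sub>v c))"

definition pos_reals :: "complex set" where
  "pos_reals = complex_of_real ` {0<..}"

definition neg_reals :: "complex set" where
  "neg_reals = complex_of_real ` {..<0}"

end

theory Submission
  imports
    Defs
    "Jordan_Normal_Form.Jordan_Normal_Form_Uniqueness"
begin

text \<open>
  Put \<open>M = Q\<^sup>* S Q\<close> and \<open>N = Q\<^sup>* S H Q\<close>. Both are hermitian, \<open>N\<close> is positive definite since \<open>Q\<close> is
  injective, and \<open>M G = N\<close>. So \<open>G\<close> is symmetric for the inner product given by \<open>N\<close>; it is therefore
  diagonalizable with real eigenvalues, none of them zero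
  (\<open>pencil_eigenvalue_real\<close>, \<open>pencil_diagonalizable\<close>). Symmetry enters the diagonalization through the
  Jordan form: it forbids generalized eigenvectors, which makes every Jordan block trivial.

  The pairing of the eigenvalues comes from an antilinear involution. The map that conjugates a vector
  and then applies \<open>K\<close> exchanges \<open>W\<^sub>+\<close> and \<open>W\<^sub>-\<close>, hence preserves the range of \<open>W\<close>, which is the range of
  \<open>Q\<close>. In the coordinates of \<open>Q\<close> it becomes \<open>v \<mapsto> T cnj(v)\<close> for a matrix \<open>T\<close> with \<open>K cnj(Q) = Q T\<close>. As \<open>K\<close>
  negates \<open>S\<close> by conjugation but carries \<open>S H\<close> to its complex conjugate, this map anticommutes with \<open>G\<close>
  (\<open>conj_symmetry_compression\<close>). It thus sends an eigenvector for a real \<open>\<mu>\<close> to one for \<open>- \<mu>\<close>, and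
  \<open>Z\<^sub>- = T cnj(Z\<^sub>+)\<close> is a valid choice, with \<open>Q Z\<^sub>- = K cnj(Q Z\<^sub>+)\<close> by the definition of \<open>T\<close>
  (\<open>conj_symmetry_eigenvector_matrix\<close>).

  Finally, two eigenvector matrices for the same set of eigenvalues have similar eigenvalue matrices
  (\<open>eigenvector_matrix_unique\<close>). This turns the existence of that particular \<open>Z\<^sub>-\<close> into the statements
  about arbitrary choices: equal multiplicities of \<open>\<mu>\<close> and \<open>- \<mu>\<close>, equally many positive and negative
  eigenvalues, and \<open>\<Lambda>\<^sub>- = - \<Lambda>\<^sub>+\<close> up to a permutation.
\<close>

section \<open>Full column rank and uniqueness of eigenvector matrices\<close>

lemma mult_mat_unit_vec:
  assumes M: "(M :: complex mat) \<in> carrier_mat n l" and j: "j < l"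
  shows "M *\<^sub>v unit_vec l j = col M j"
  using col_mult2[OF M one_carrier_mat j] M j by simp

text \<open>Repeated columns are the delicate point: the rank is the dimension of the span of the \<^emph>\<open>set\<close> of
  columns, so distinctness of the columns has to be derived on either side before linear independence
  of that set can be used.\<close>
lemma full_column_rank_iff_injective:
  "full_column_rank M \<longleftrightarrow>
     (\<forall>v \<in> carrier_vec (dim_col M). M *\<^sub>v v = 0\<^sub>v (dim_row M) \<longrightarrow> v = 0\<^sub>v (dim_col M))"
  (is "_ \<longleftrightarrow> ?inj")
proof -
  interpret vec_space "TYPE(complex)" "dim_row M" .
  have M: "M \<in> carrier_mat (dim_row M) (dim_col M)" by simp
  show ?thesis
  proof
    assume "full_column_rank M"
    hence r: "rank M = dim_col M" by (simp add: full_column_rank_def)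
    have d: "distinct (cols M)"
    proof (rule ccontr)
      assume nd: "\<not> distinct (cols M)"
      obtain S where S: "maximal S (\<lambda>T. T \<subseteq> set (cols M) \<and> lin_indpt T)"
        using maximal_exists[of "\<lambda>T. T \<subseteq> set (cols M) \<and> lin_indpt T" "card (set (cols M))" "{}"]
        by (meson List.finite_set card_mono empty_iff empty_subsetI finite_lin_indpt2 rev_finite_subset)
      hence "card S \<le> card (set (cols M))" by (simp add: card_mono maximal_def)
      also have "\<dots> < length (cols M)"
        using nd by (meson card_distinct card_length order_le_less)
      finally show False using rank_card_indpt[OF M S] r by simp
    qed
    show ?inj using lin_depI[OF M _ _ _ d] full_rank_lin_indpt[OF M r d] by blast
  next
    assume inj: ?inj
    have d: "distinct (cols M)"
    proof (rule ccontr)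
      assume "\<not> distinct (cols M)"
      then obtain i j where ij: "i < dim_col M" "j < dim_col M" "i \<noteq> j" "col M i = col M j"
        by (auto simp: distinct_conv_nth)
      let ?v = "unit_vec (dim_col M) i - unit_vec (dim_col M) j :: complex vec"
      have "M *\<^sub>v ?v = M *\<^sub>v unit_vec (dim_col M) i - M *\<^sub>v unit_vec (dim_col M) j"
        by (rule mult_minus_distrib_mat_vec[OF M]) auto
      also have "\<dots> = col M i - col M j"
        using mult_mat_unit_vec[OF M] ij(1,2) by simp
      finally have "M *\<^sub>v ?v = 0\<^sub>v (dim_row M)" using ij by auto
      moreover have "?v \<in> carrier_vec (dim_col M)" by simp
      ultimately have "?v = 0\<^sub>v (dim_col M)" using inj by blast
      hence "?v $ i = 0" using ij by simp
      thus False using ij by simp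
    qed
    have "lin_indpt (set (cols M))"
      using lin_depE[OF M _ d] inj by metis
    from lin_indpt_full_rank[OF M d this] show "full_column_rank M"
      by (simp add: full_column_rank_def)
  qed
qed

lemma full_column_rank_cancel:
  assumes Z: "Z \<in> carrier_mat n l" "full_column_rank Z"
    and C: "C \<in> carrier_mat l r" and D: "D \<in> carrier_mat l r"
    and eq: "Z * C = Z * D"
  shows "C = D"
proof -
  have "col C j = col D j" if j: "j < r" for j
  proof -
    have c: "col C j \<in> carrier_vec l" "col D j \<in> carrier_vec l" using C D by auto
    have "Z *\<^sub>v (col C j - col D j) = Z *\<^sub>v col C j - Z *\<^sub>v col D j"
      by (rule mult_minus_distrib_mat_vec[OF Z(1) c])
    also have "Z *\<^sub>v col C j = Z *\<^sub>v col D j"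
      using eq col_mult2[OF Z(1) C j] col_mult2[OF Z(1) D j] by simp
    also have "\<dots> - Z *\<^sub>v col D j = 0\<^sub>v n" using Z by auto
    finally have "col C j - col D j = 0\<^sub>v l"
      using Z c unfolding full_column_rank_iff_injective by (auto simp: carrier_matD[OF Z(1)])
    hence "(col C j - col D j) $ i = 0" if "i < l" for i using that by simp
    hence "col C j $ i = col D j $ i" if "i < l" for i
      using that c by (metis index_minus_vec(1) carrier_vecD right_minus_eq)
    thus ?thesis using c unfolding vec_eq_iff by (metis carrier_vecD)
  qed
  thus ?thesis using C D by (intro mat_col_eqI) auto
qed

lemma eigenvector_matrix_col:
  assumes ev: "eigenvector_matrix G E Z L" and G: "G \<in> carrier_mat n n" and j: "j < dim_row L"
  shows "eigenvector G (col Z j) (L $$ (j, j))"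
proof -
  define l where "l = dim_row L"
  have Z: "Z \<in> carrier_mat n l" and L: "L \<in> carrier_mat l l" and GZ: "G * Z = Z * L"
    and rk: "full_column_rank Z" and dg: "diagonal_mat L"
    using ev G by (auto simp: eigenvector_matrix_def l_def square_mat.simps)
  have j: "j < l" using j l_def by simp
  have "col L j = L $$ (j, j) \<cdot>\<^sub>v unit_vec l j"
    using L j dg by (intro eq_vecI) (auto simp: diagonal_mat_def)
  hence "Z *\<^sub>v col L j = L $$ (j, j) \<cdot>\<^sub>v col Z j"
    using mult_mat_vec[OF Z] mult_mat_unit_vec[OF Z j] by simp
  hence "G *\<^sub>v col Z j = L $$ (j, j) \<cdot>\<^sub>v col Z j"
    using GZ col_mult2[OF G Z j] col_mult2[OF Z L j] by simp
  moreover have "col Z j \<noteq> 0\<^sub>v n"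
  proof
    assume "col Z j = 0\<^sub>v n"
    hence "Z *\<^sub>v unit_vec l j = 0\<^sub>v n" using mult_mat_unit_vec[OF Z j] by simp
    hence "(unit_vec l j :: complex vec) = 0\<^sub>v l"
      using rk Z unfolding full_column_rank_iff_injective by auto
    thus False using j by simp
  qed
  ultimately show ?thesis using Z G by (auto simp: eigenvector_def)
qed

text \<open>Each column of the second matrix is an eigenvector for an eigenvalue in \<open>E\<close>, hence by maximality a
  combination of the columns of the first.\<close>
lemma eigenvector_matrix_factor:
  assumes e1: "eigenvector_matrix G E Z\<^sub>1 L\<^sub>1" and e2: "eigenvector_matrix G E Z\<^sub>2 L\<^sub>2"
    and G: "G \<in> carrier_mat n n"
  shows "\<exists>C \<in> carrier_mat (dim_row L\<^sub>1) (dim_row L\<^sub>2). Z\<^sub>2 = Z\<^sub>1 * C"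
proof -
  define l\<^sub>1 l\<^sub>2 where "l\<^sub>1 = dim_row L\<^sub>1" and "l\<^sub>2 = dim_row L\<^sub>2"
  have Z: "Z\<^sub>1 \<in> carrier_mat n l\<^sub>1" "Z\<^sub>2 \<in> carrier_mat n l\<^sub>2"
    using e1 e2 G by (auto simp: eigenvector_matrix_def l\<^sub>1_def l\<^sub>2_def)
  have "\<exists>c \<in> carrier_vec l\<^sub>1. col Z\<^sub>2 j = Z\<^sub>1 *\<^sub>v c" if "j < l\<^sub>2" for j
    using eigenvector_matrix_col[OF e2 G] that e1 e2 Z
    unfolding eigenvector_matrix_def l\<^sub>2_def by (metis carrier_matD(2))
  then obtain c where c: "\<And>j. j < l\<^sub>2 \<Longrightarrow> c j \<in> carrier_vec l\<^sub>1 \<and> col Z\<^sub>2 j = Z\<^sub>1 *\<^sub>v c j"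
    by metis
  define C where "C = mat_of_cols l\<^sub>1 (map c [0..<l\<^sub>2])"
  have C: "C \<in> carrier_mat l\<^sub>1 l\<^sub>2" by (auto simp: C_def)
  have "Z\<^sub>2 = Z\<^sub>1 * C"
  proof (rule mat_col_eqI)
    fix j assume "j < dim_col (Z\<^sub>1 * C)"
    hence j: "j < l\<^sub>2" using C by simp
    have "col C j = c j" using j c by (simp add: C_def)
    thus "col Z\<^sub>2 j = col (Z\<^sub>1 * C) j" using col_mult2[OF Z(1) C j] c[OF j] by simp
  qed (use Z C in auto)
  thus ?thesis using C l\<^sub>1_def l\<^sub>2_def by auto
qed

text \<open>Both products have the same trace, and in characteristic zero the trace of an identity matrix
  determines its size.\<close>
lemma two_sided_inverse_imp_square:
  assumes C: "C \<in> carrier_mat r s" and D: "D \<in> carrier_mat s r"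
    and CD: "C * D = 1\<^sub>m r" and DC: "D * C = (1\<^sub>m s :: complex mat)"
  shows "r = s"
proof -
  have "of_nat r = (\<Sum>i<r. (C * D) $$ (i, i))" unfolding CD by simp
  also have "\<dots> = (\<Sum>i<r. \<Sum>j<s. C $$ (i, j) * D $$ (j, i))"
    using C D by (simp add: scalar_prod_def lessThan_atLeast0)
  also have "\<dots> = (\<Sum>j<s. \<Sum>i<r. D $$ (j, i) * C $$ (i, j))"
    by (subst sum.swap) (simp add: mult.commute)
  also have "\<dots> = (\<Sum>j<s. (D * C) $$ (j, j))"
    using C D by (simp add: scalar_prod_def lessThan_atLeast0)
  also have "\<dots> = (of_nat s :: complex)" unfolding DC by simp
  finally show ?thesis by simp
qed

text \<open>The factors that express two eigenvector matrices through each other are mutually inverse because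
  both matrices are injective; comparing the two diagonalizations shows that they conjugate one
  eigenvalue matrix into the other. So number and multiplicities of the collected eigenvalues depend
  only on \<open>G\<close> and \<open>E\<close>.\<close>
lemma eigenvector_matrix_unique:
  assumes e1: "eigenvector_matrix G E Z\<^sub>1 L\<^sub>1" and e2: "eigenvector_matrix G E Z\<^sub>2 L\<^sub>2"
    and G: "G \<in> carrier_mat n n"
  shows "similar_mat L\<^sub>1 L\<^sub>2"
proof -
  define l\<^sub>1 l\<^sub>2 where "l\<^sub>1 = dim_row L\<^sub>1" and "l\<^sub>2 = dim_row L\<^sub>2"
  have Z: "Z\<^sub>1 \<in> carrier_mat n l\<^sub>1" "Z\<^sub>2 \<in> carrier_mat n l\<^sub>2"
    and L: "L\<^sub>1 \<in> carrier_mat l\<^sub>1 l\<^sub>1" "L\<^sub>2 \<in> carrier_mat l\<^sub>2 l\<^sub>2"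
    and GZ: "G * Z\<^sub>1 = Z\<^sub>1 * L\<^sub>1" "G * Z\<^sub>2 = Z\<^sub>2 * L\<^sub>2"
    and rk: "full_column_rank Z\<^sub>1" "full_column_rank Z\<^sub>2"
    using e1 e2 G by (auto simp: eigenvector_matrix_def l\<^sub>1_def l\<^sub>2_def square_mat.simps)
  obtain C D where C: "C \<in> carrier_mat l\<^sub>1 l\<^sub>2" "Z\<^sub>2 = Z\<^sub>1 * C"
    and D: "D \<in> carrier_mat l\<^sub>2 l\<^sub>1" "Z\<^sub>1 = Z\<^sub>2 * D"
    using eigenvector_matrix_factor[OF e1 e2 G] eigenvector_matrix_factor[OF e2 e1 G]
    unfolding l\<^sub>1_def l\<^sub>2_def by blast
  have "Z\<^sub>1 * (C * D) = Z\<^sub>1 * 1\<^sub>m l\<^sub>1"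
    using assoc_mult_mat[OF Z(1) C(1) D(1), symmetric]
      C(2)[symmetric] D(2)[symmetric] Z by simp
  hence CD: "C * D = 1\<^sub>m l\<^sub>1"
    by (rule full_column_rank_cancel[OF Z(1) rk(1) mult_carrier_mat[OF C(1) D(1)] one_carrier_mat])
  have "Z\<^sub>2 * (D * C) = Z\<^sub>2 * 1\<^sub>m l\<^sub>2"
    using assoc_mult_mat[OF Z(2) D(1) C(1), symmetric]
      C(2)[symmetric] D(2)[symmetric] Z by simp
  hence DC: "D * C = 1\<^sub>m l\<^sub>2"
    by (rule full_column_rank_cancel[OF Z(2) rk(2) mult_carrier_mat[OF D(1) C(1)] one_carrier_mat])
  have l: "l\<^sub>1 = l\<^sub>2" using two_sided_inverse_imp_square[OF C(1) D(1) CD DC] .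
  have "Z\<^sub>1 * (L\<^sub>1 * C) = Z\<^sub>1 * L\<^sub>1 * C" using assoc_mult_mat[OF Z(1) L(1) C(1)] by simp
  also have "\<dots> = G * Z\<^sub>2" using assoc_mult_mat[OF G Z(1) C(1)] GZ C(2)[symmetric] by simp
  also have "\<dots> = Z\<^sub>1 * (C * L\<^sub>2)" using assoc_mult_mat[OF Z(1) C(1) L(2)] GZ C(2)[symmetric] by simp
  finally have "L\<^sub>1 * C = C * L\<^sub>2"
    by (rule full_column_rank_cancel[OF Z(1) rk(1)
          mult_carrier_mat[OF L(1) C(1)] mult_carrier_mat[OF C(1) L(2)]])
  hence "C * L\<^sub>2 * D = L\<^sub>1 * (C * D)" using assoc_mult_mat[OF L(1) C(1) D(1)] by simp
  hence "L\<^sub>1 = C * L\<^sub>2 * D" using CD L by simp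
  thus ?thesis
    using similar_matI[of L\<^sub>1 L\<^sub>2 C D l\<^sub>1] CD DC L C D l by auto
qed

lemma order_char_poly_diagonal:
  assumes D: "D \<in> carrier_mat n n" "diagonal_mat D"
  shows "Polynomial.order \<mu> (char_poly (D :: complex mat)) = count (mset (diag_mat D)) \<mu>"
proof -
  have "upper_triangular D" using D by (auto simp: diagonal_mat_def)
  hence "char_poly D = (\<Prod>a\<leftarrow>diag_mat D. [:- a, 1:])" by (rule char_poly_upper_triangular[OF D(1)])
  moreover have "(\<Prod>a\<leftarrow>xs. [:- a, 1:]) \<noteq> 0 \<and>
      Polynomial.order \<mu> (\<Prod>a\<leftarrow>xs. [:- a, 1:]) = count (mset xs) \<mu>" for xs :: "complex list"
  proof (induction xs)
    case (Cons a xs)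
    have "Polynomial.order \<mu> [:- a, 1:] = (if \<mu> = a then 1 else 0)"
      by (simp add: order_linear')
    thus ?case using Cons by (auto simp: order_mult simp del: mult_pCons_left)
  qed simp
  ultimately show ?thesis by simp
qed

text \<open>The multiplicity of a diagonal entry is its order as a root of the characteristic polynomial,
  which is invariant under similarity.\<close>
lemma similar_diagonal_mset:
  assumes s: "similar_mat D E" and dD: "diagonal_mat D" and dE: "diagonal_mat (E :: complex mat)"
  shows "mset (diag_mat D) = mset (diag_mat E)"
proof -
  obtain n where "D \<in> carrier_mat n n" "E \<in> carrier_mat n n" using similar_matD[OF s] by auto
  thus ?thesis
    using order_char_poly_diagonal char_poly_similar[OF s] dD dE by (intro multiset_eqI) metis
qed

section \<open>Conjugates, adjoints and hermitian forms\<close>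

lemma mat_adjoint_eq_transpose_cnj: "mat_adjoint A = transpose_mat (cnj_mat A)"
proof (rule eq_matI)
  fix i j assume "i < dim_row (transpose_mat (cnj_mat A))" "j < dim_col (transpose_mat (cnj_mat A))"
  thus "mat_adjoint A $$ (i, j) = transpose_mat (cnj_mat A) $$ (i, j)"
    by (simp add: mat_adjoint_def mat_of_rows_index conjugate_complex_def)
qed (simp_all add: mat_adjoint_def)

lemma cnj_mat_mult:
  assumes "A \<in> carrier_mat r s" "B \<in> carrier_mat s t"
  shows "cnj_mat (A * B) = cnj_mat A * cnj_mat B"
  using assms by (intro eq_matI) (auto simp: scalar_prod_def)

lemma cnj_mat_mult_vec:
  assumes "A \<in> carrier_mat r s" "v \<in> carrier_vec s"
  shows "map_vec cnj (A *\<^sub>v v) = cnj_mat A *\<^sub>v map_vec cnj v"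
  using assms by (intro eq_vecI) (auto simp: scalar_prod_def)

lemma cnj_mat_cnj_mat [simp]: "cnj_mat (cnj_mat A) = A"
  by (intro eq_matI) auto

lemma cnj_vec_cnj_vec [simp]: "map_vec cnj (map_vec cnj v) = v"
  by (intro eq_vecI) auto

lemma mat_adjoint_carrier: "(A :: complex mat) \<in> carrier_mat r s \<Longrightarrow> mat_adjoint A \<in> carrier_mat s r"
  by (simp add: mat_adjoint_eq_transpose_cnj)

lemma mat_adjoint_mult:
  assumes "(A :: complex mat) \<in> carrier_mat r s" "B \<in> carrier_mat s t"
  shows "mat_adjoint (A * B) = mat_adjoint B * mat_adjoint A"
  using assms by (simp add: mat_adjoint_eq_transpose_cnj cnj_mat_mult)
    (rule transpose_mult[of _ r s _ t], auto)

lemma mat_adjoint_mat_adjoint [simp]: "mat_adjoint (mat_adjoint A) = (A :: complex mat)"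
  by (intro eq_matI) (auto simp: mat_adjoint_eq_transpose_cnj)

lemma inner_mat_adjoint:
  fixes A :: "complex mat"
  assumes A: "A \<in> carrier_mat r s" and v: "v \<in> carrier_vec s" and w: "w \<in> carrier_vec r"
  shows "(A *\<^sub>v v) \<bullet>c w = v \<bullet>c (mat_adjoint A *\<^sub>v w)"
proof -
  have "(A *\<^sub>v v) \<bullet>c w = (\<Sum>i<r. \<Sum>j<s. A $$ (i, j) * v $ j * cnj (w $ i))"
    using assms by (simp add: scalar_prod_def sum_distrib_right lessThan_atLeast0 conjugate_complex_def)
  also have "\<dots> = (\<Sum>j<s. \<Sum>i<r. A $$ (i, j) * v $ j * cnj (w $ i))" by (rule sum.swap)
  also have "\<dots> = v \<bullet>c (mat_adjoint A *\<^sub>v w)"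
    using assms
    by (simp add: mat_adjoint_eq_transpose_cnj scalar_prod_def sum_distrib_left lessThan_atLeast0
        conjugate_complex_def mult_ac)
  finally show ?thesis .
qed

lemma inner_swap:
  fixes v w :: "complex vec"
  assumes "v \<in> carrier_vec n" "w \<in> carrier_vec n"
  shows "w \<bullet>c v = cnj (v \<bullet>c w)"
  using assms by (simp add: scalar_prod_def conjugate_complex_def mult.commute)

lemma hermitian_form_real:
  fixes A :: "complex mat"
  assumes A: "A \<in> carrier_mat n n" "mat_adjoint A = A" and v: "v \<in> carrier_vec n"
  shows "(A *\<^sub>v v) \<bullet>c v \<in> \<real>"
proof -
  have "(A *\<^sub>v v) \<bullet>c v = cnj ((A *\<^sub>v v) \<bullet>c v)"
    using inner_mat_adjoint[OF A(1) v v] inner_swap[of v n "A *\<^sub>v v"] A v by simp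
  thus ?thesis by (metis Reals_cnj_iff)
qed

section \<open>Hermitian pencils with one positive definite member\<close>

text \<open>From \<open>G v = \<mu> v\<close> follows \<open>N v = \<mu> M v\<close>; pairing with \<open>v\<close> writes a positive number as \<open>\<mu>\<close> times a real
  one.\<close>
lemma pencil_eigenvalue_real:
  assumes M: "M \<in> carrier_mat n n" "mat_adjoint M = M"
    and N: "N \<in> carrier_mat n n" "hermitian_pos_def N"
    and G: "G \<in> carrier_mat n n" "M * G = N" and ev: "eigenvector G v \<mu>"
  shows "\<mu> \<in> \<real>" "\<mu> \<noteq> 0"
proof -
  have v: "v \<in> carrier_vec n" "v \<noteq> 0\<^sub>v n" "G *\<^sub>v v = \<mu> \<cdot>\<^sub>v v"
    using ev G by (auto simp: eigenvector_def)
  let ?a = "(N *\<^sub>v v) \<bullet>c v" and ?c = "(M *\<^sub>v v) \<bullet>c v"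
  have "N *\<^sub>v v = \<mu> \<cdot>\<^sub>v (M *\<^sub>v v)"
    using G M v by (metis assoc_mult_mat_vec mult_mat_vec)
  hence eq: "?a = \<mu> * ?c" using M v by simp
  have "?a \<in> \<real>" "?c \<in> \<real>"
    using hermitian_form_real[OF N(1) _ v(1)] hermitian_form_real[OF M v(1)] N(2)
    by (auto simp: hermitian_pos_def_def)
  moreover have "Re ?a > 0" using N v by (auto simp: hermitian_pos_def_def)
  hence a: "?a \<noteq> 0" by auto
  hence c: "?c \<noteq> 0" using eq by auto
  ultimately show "\<mu> \<in> \<real>" using eq by (metis Reals_divide nonzero_eq_divide_eq)
  show "\<mu> \<noteq> 0" using a eq by auto
qed

text \<open>The matrix \<open>G = M\<inverse> N\<close> is symmetric for the inner product given by \<open>N\<close>, and a symmetric operator has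
  no generalized eigenvectors beyond the eigenvectors: if \<open>w = (G - \<mu>) v\<close> is killed by \<open>G - \<mu>\<close>, then \<open>\<mu>\<close>
  is real and \<open>w\<close> is orthogonal to itself.\<close>
lemma pencil_no_generalized_eigenvector:
  assumes M: "M \<in> carrier_mat n n" "mat_adjoint M = M"
    and N: "N \<in> carrier_mat n n" "hermitian_pos_def N"
    and G: "G \<in> carrier_mat n n" "M * G = N"
  shows "mat_kernel (char_matrix G \<mu> * char_matrix G \<mu>) = mat_kernel (char_matrix G \<mu>)"
proof -
  let ?C = "char_matrix G \<mu>"
  have C: "?C \<in> carrier_mat n n" using G by simp
  have Nh: "mat_adjoint N = N" using N by (simp add: hermitian_pos_def_def)
  have "?C *\<^sub>v v = 0\<^sub>v n" if v: "v \<in> carrier_vec n" and CC: "?C *\<^sub>v (?C *\<^sub>v v) = 0\<^sub>v n" for v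
  proof (rule ccontr)
    define w where "w = ?C *\<^sub>v v"
    assume w0: "?C *\<^sub>v v \<noteq> 0\<^sub>v n"
    have w: "w \<in> carrier_vec n" using C v by (simp add: w_def)
    have ev: "eigenvector G w \<mu>"
      using eigenvector_char_matrix[OF G(1)] w w0 CC by (simp add: w_def)
    have \<mu>: "\<mu> \<in> \<real>" using pencil_eigenvalue_real[OF M N G ev] by simp
    have Gw: "G *\<^sub>v w = \<mu> \<cdot>\<^sub>v w" using ev by (simp add: eigenvector_def)
    have Nw: "N *\<^sub>v w = \<mu> \<cdot>\<^sub>v (M *\<^sub>v w)"
      using G M w Gw by (metis assoc_mult_mat_vec mult_mat_vec)
    have Gv: "G *\<^sub>v v \<in> carrier_vec n" using G v by simp
    \<comment> \<open>Expand the second factor of \<open>(N *\<^sub>v w) \<bullet>c w\<close>: since \<open>G\<close> is symmetric for the form of \<open>N\<close>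
      and \<open>\<mu>\<close> is real, the two terms cancel, against positivity.\<close>
    have wdef: "w = G *\<^sub>v v + (- \<mu>) \<cdot>\<^sub>v v"
      unfolding w_def char_matrix_def using G v
      by (intro eq_vecI) (auto simp: add_scalar_prod_distrib[of _ n])
    have "(N *\<^sub>v w) \<bullet>c (G *\<^sub>v v) = \<mu> * ((M *\<^sub>v w) \<bullet>c (G *\<^sub>v v))"
      using Nw M w Gv by (simp add: smult_scalar_prod_distrib[of _ n])
    also have "(M *\<^sub>v w) \<bullet>c (G *\<^sub>v v) = w \<bullet>c (M *\<^sub>v (G *\<^sub>v v))"
      using inner_mat_adjoint[OF M(1) w Gv] M(2) by simp
    also have "M *\<^sub>v (G *\<^sub>v v) = N *\<^sub>v v"
      using assoc_mult_mat_vec[OF M(1) G(1) v] G(2) by simp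
    also have "w \<bullet>c (N *\<^sub>v v) = (N *\<^sub>v w) \<bullet>c v"
      using inner_mat_adjoint[OF N(1) w v] Nh by simp
    finally have 1: "(N *\<^sub>v w) \<bullet>c (G *\<^sub>v v) = \<mu> * ((N *\<^sub>v w) \<bullet>c v)" .
    have "(N *\<^sub>v w) \<bullet>c w = (N *\<^sub>v w) \<bullet>c (G *\<^sub>v v) - \<mu> * ((N *\<^sub>v w) \<bullet>c v)"
    proof -
      have "conjugate w = conjugate (G *\<^sub>v v) + (- \<mu>) \<cdot>\<^sub>v conjugate v"
        using \<mu> v Gv conjugate_add_vec[of "G *\<^sub>v v" n "(- \<mu>) \<cdot>\<^sub>v v"]
        by (subst wdef) (simp add: conjugate_smult_vec conjugate_complex_def Reals_cnj_iff)
      thus ?thesis using N w v Gv by (simp add: scalar_prod_add_distrib[of _ n])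
    qed
    hence "(N *\<^sub>v w) \<bullet>c w = 0" using 1 by simp
    thus False using N w w0 by (auto simp: hermitian_pos_def_def w_def)
  qed
  thus ?thesis using C by (auto simp: mat_kernel_def assoc_mult_mat_vec[of _ n n _ n])
qed

lemma diagonal_jordan_matrix:
  assumes "\<forall>(n, a) \<in> set xs. n = 1"
  shows "diagonal_mat (jordan_matrix xs :: complex mat)"
  using assms
proof (induction xs)
  case Nil
  thus ?case by (simp add: jordan_matrix_def diagonal_mat_def)
next
  case (Cons x xs)
  then obtain a where x: "x = (1, a)" by (cases x) auto
  have "diagonal_mat (jordan_matrix xs :: complex mat)" using Cons by simp
  thus ?case unfolding x jordan_matrix_Cons
    by (auto simp: diagonal_mat_def jordan_block_def)
qed

text \<open>The two sums will be the dimensions of the kernels of the first and the second power of \<open>G - \<mu>\<close>,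
  with \<open>xs\<close> the sizes of the Jordan blocks for \<open>\<mu>\<close>.\<close>
lemma sum_list_min_one_two:
  assumes "(\<Sum>n\<leftarrow>xs. min 1 n) = (\<Sum>n\<leftarrow>xs. min 2 n)" "n \<in> set xs"
  shows "n \<le> (1::nat)"
  using assms
proof (induction xs)
  case (Cons x xs)
  have "(\<Sum>n\<leftarrow>xs. min 1 n) \<le> (\<Sum>n\<leftarrow>xs. min 2 n)" by (rule sum_list_mono) auto
  thus ?case using Cons by (auto simp: min_def split: if_splits)
qed simp

text \<open>Equality of the kernels of \<open>G - \<mu>\<close> and its square leaves only Jordan blocks of size one.\<close>
lemma pencil_diagonalizable:
  assumes M: "M \<in> carrier_mat n n" "mat_adjoint M = M"
    and N: "N \<in> carrier_mat n n" "hermitian_pos_def N"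
    and G: "G \<in> carrier_mat n n" "M * G = N"
  shows "\<exists>D P P'. diagonal_mat D \<and> similar_mat_wit G D P P'"
proof -
  obtain xs where xs: "jordan_nf G xs"
    using char_poly_factorized[OF G(1)] jordan_nf_exists[OF G(1)] by blast
  have "n' = 1" if na: "(n', a) \<in> set xs" for n' a
  proof -
    let ?C = "char_matrix G a"
    have C: "?C \<in> carrier_mat n n" using G by simp
    have "?C ^\<^sub>m 1 = ?C" "?C ^\<^sub>m 2 = ?C * ?C"
      using C by (simp_all add: numeral_2_eq_2)
    hence "mat_kernel (?C ^\<^sub>m 2) = mat_kernel (?C ^\<^sub>m 1)"
      using pencil_no_generalized_eigenvector[OF M N G] by simp
    \<comment> \<open>A block of size \<open>n\<close> contributes \<open>min r n\<close> to the dimension of the kernel of the \<open>r\<close>-th power.\<close>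
    hence "dim_gen_eigenspace G a 1 = dim_gen_eigenspace G a 2"
      using C by (simp add: dim_gen_eigenspace_def kernel_dim_def)
    moreover have "n' \<in> set (map fst [(n, e)\<leftarrow>xs . e = a])" using na by force
    ultimately have "n' \<le> 1"
      unfolding dim_gen_eigenspace[OF xs] using sum_list_min_one_two by blast
    moreover have "n' \<noteq> 0" using xs na unfolding jordan_nf_def by force
    ultimately show ?thesis by simp
  qed
  hence "diagonal_mat (jordan_matrix xs)" by (intro diagonal_jordan_matrix) auto
  thus ?thesis using xs unfolding jordan_nf_def similar_mat_def by blast
qed

section \<open>Eigenvector matrices of a diagonalizable matrix\<close>

lemma diagonal_mult_index:
  assumes D: "D \<in> carrier_mat n n" "diagonal_mat (D :: complex mat)" and X: "X \<in> carrier_mat n l"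
    and ij: "i < n" "j < l"
  shows "(D * X) $$ (i, j) = D $$ (i, i) * X $$ (i, j)"
proof -
  have "(D * X) $$ (i, j) = (\<Sum>k<n. D $$ (i, k) * X $$ (k, j))"
    using D X ij by (simp add: scalar_prod_def lessThan_atLeast0)
  also have "\<dots> = (\<Sum>k<n. if k = i then D $$ (i, i) * X $$ (i, j) else 0)"
    using D ij by (intro sum.cong) (auto simp: diagonal_mat_def)
  finally show ?thesis using ij by simp
qed

lemma mult_diagonal_index:
  assumes X: "X \<in> carrier_mat n l" and L: "L \<in> carrier_mat l l" "diagonal_mat (L :: complex mat)"
    and ij: "i < n" "j < l"
  shows "(X * L) $$ (i, j) = X $$ (i, j) * L $$ (j, j)"
proof -
  have "(X * L) $$ (i, j) = (\<Sum>k<l. X $$ (i, k) * L $$ (k, j))"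
    using L X ij by (simp add: scalar_prod_def lessThan_atLeast0)
  also have "\<dots> = (\<Sum>k<l. if k = j then X $$ (i, j) * L $$ (j, j) else 0)"
    using L ij by (intro sum.cong) (auto simp: diagonal_mat_def)
  finally show ?thesis using ij by simp
qed

lemma diagonal_mult_vec_index:
  assumes D: "D \<in> carrier_mat n n" "diagonal_mat (D :: complex mat)" and w: "w \<in> carrier_vec n"
    and i: "i < n"
  shows "(D *\<^sub>v w) $ i = D $$ (i, i) * w $ i"
proof -
  have "(D *\<^sub>v w) $ i = (\<Sum>k<n. D $$ (i, k) * w $ k)"
    using D w i by (simp add: scalar_prod_def lessThan_atLeast0)
  also have "\<dots> = (\<Sum>k<n. if k = i then D $$ (i, i) * w $ i else 0)"
    using D i by (intro sum.cong) (auto simp: diagonal_mat_def)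
  finally show ?thesis using i by simp
qed

text \<open>The columns of the diagonalizing matrix that belong to eigenvalues in \<open>E\<close> form an eigenvector
  matrix.\<close>
lemma eigenvector_matrix_exists:
  assumes wit: "similar_mat_wit G D P P'" and G: "G \<in> carrier_mat n n" and dD: "diagonal_mat D"
  shows "\<exists>Z L. eigenvector_matrix G E Z L \<and> dim_row L = length (filter (\<lambda>d. d \<in> E) (diag_mat D))"
proof -
  note PP = similar_mat_witD2[OF G wit]
  have D: "D \<in> carrier_mat n n" and P: "P \<in> carrier_mat n n" and P': "P' \<in> carrier_mat n n"
    using PP by auto
  define sel where "sel = filter (\<lambda>i. D $$ (i, i) \<in> E) [0..<n]"
  define l where "l = length sel"
  \<comment> \<open>\<open>X\<close> selects the columns of \<open>P\<close> that belong to eigenvalues in \<open>E\<close>.\<close>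
  define X :: "complex mat" where "X = mat n l (\<lambda>(i, j). if i = sel ! j then 1 else 0)"
  define L where "L = mat l l (\<lambda>(i, j). if i = j then D $$ (sel ! i, sel ! i) else 0)"
  have X: "X \<in> carrier_mat n l" and L: "L \<in> carrier_mat l l" by (auto simp: X_def L_def)
  have dL: "diagonal_mat L" by (auto simp: L_def diagonal_mat_def)
  have dist: "distinct sel" by (simp add: sel_def)
  have nth: "sel ! j < n" "D $$ (sel ! j, sel ! j) \<in> E" if "j < l" for j
    using nth_mem[of j sel] that unfolding l_def by (auto simp: sel_def)
  have DX: "D * X = X * L"
  proof (rule eq_matI)
    fix i j assume "i < dim_row (X * L)" "j < dim_col (X * L)"
    hence ij: "i < n" "j < l" using X L by auto
    show "(D * X) $$ (i, j) = (X * L) $$ (i, j)"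
      unfolding diagonal_mult_index[OF D dD X ij] mult_diagonal_index[OF X L dL ij]
      using ij by (auto simp: X_def L_def)
  qed (use D X L in auto)
  have Xc: "(X *\<^sub>v c) $ (sel ! j) = c $ j" if c: "c \<in> carrier_vec l" and j: "j < l" for c j
  proof -
    have "(X *\<^sub>v c) $ (sel ! j) = (\<Sum>k<l. (if sel ! j = sel ! k then 1 else 0) * c $ k)"
      using c nth(1)[OF j] by (simp add: X_def scalar_prod_def lessThan_atLeast0)
    also have "\<dots> = (\<Sum>k<l. if k = j then c $ j else 0)"
      using dist j by (intro sum.cong) (auto simp: nth_eq_iff_index_eq l_def)
    finally show ?thesis using j by simp
  qed
  define Z where "Z = P * X"
  have Z: "Z \<in> carrier_mat n l" using P X by (simp add: Z_def)
  have P'Z: "P' *\<^sub>v (Z *\<^sub>v c) = X *\<^sub>v c" if c: "c \<in> carrier_vec l" for c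
    using PP(2) assoc_mult_mat_vec[OF P X c] X c
      assoc_mult_mat_vec[OF P' P, of "X *\<^sub>v c"] by (simp add: Z_def)
  have "G * Z = P * D * (P' * P) * X"
    unfolding PP(3) Z_def using P P' D X
    by (simp add: assoc_mult_mat[of _ n n _ n _ n] assoc_mult_mat[of _ n n _ n _ l])
  also have "\<dots> = P * (D * X)" using PP(2) P D X by (simp add: assoc_mult_mat[of _ n n _ n _ l])
  also have "\<dots> = Z * L" unfolding DX Z_def using assoc_mult_mat[OF P X L] by simp
  finally have GZ: "G * Z = Z * L" .
  have rk: "full_column_rank Z"
    unfolding full_column_rank_iff_injective
  proof (intro ballI impI)
    fix c assume "c \<in> carrier_vec (dim_col Z)" and 0: "Z *\<^sub>v c = 0\<^sub>v (dim_row Z)"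
    hence c: "c \<in> carrier_vec l" using Z by simp
    have "P' *\<^sub>v 0\<^sub>v n = 0\<^sub>v n" using P' by (intro eq_vecI) auto
    hence X0: "X *\<^sub>v c = 0\<^sub>v n" using P'Z[OF c] 0 Z by auto
    show "c = 0\<^sub>v (dim_col Z)"
    proof (rule eq_vecI)
      fix j assume "j < dim_vec (0\<^sub>v (dim_col Z) :: complex vec)"
      hence j: "j < l" using Z by simp
      show "c $ j = 0\<^sub>v (dim_col Z) $ j" using Xc[OF c j] X0 nth(1)[OF j] j Z by simp
    qed (use c Z in auto)
  qed
  have span: "\<exists>c \<in> carrier_vec l. v = Z *\<^sub>v c" if \<mu>: "\<mu> \<in> E" and ev: "eigenvector G v \<mu>" for \<mu> v
  proof -
    have v: "v \<in> carrier_vec n" "G *\<^sub>v v = \<mu> \<cdot>\<^sub>v v" using ev G by (auto simp: eigenvector_def)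
    define w where "w = P' *\<^sub>v v"
    have w: "w \<in> carrier_vec n" using P' v by (simp add: w_def)
    have Pw: "P *\<^sub>v w = v"
      using assoc_mult_mat_vec[OF P P' v(1)] PP(1) v by (simp add: w_def)
    have "D *\<^sub>v w = P' *\<^sub>v (P *\<^sub>v (D *\<^sub>v w))"
      using assoc_mult_mat_vec[OF P' P, of "D *\<^sub>v w"] PP(2) D w by simp
    also have "P *\<^sub>v (D *\<^sub>v w) = G *\<^sub>v v"
      unfolding PP(3) w_def using P P' D v
      by (simp add: assoc_mult_mat_vec[of _ n n _ n] mult_carrier_mat[of _ n n _ n])
    also have "P' *\<^sub>v (G *\<^sub>v v) = \<mu> \<cdot>\<^sub>v w" using mult_mat_vec[OF P' v(1)] v by (simp add: w_def)
    finally have Dw: "D *\<^sub>v w = \<mu> \<cdot>\<^sub>v w" .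
    \<comment> \<open>In eigencoordinates an eigenvector for \<open>\<mu>\<close> lives on the indices with diagonal entry \<open>\<mu>\<close>.\<close>
    have mem: "i \<in> set sel" if "i < n" "w $ i \<noteq> 0" for i
    proof -
      have "D $$ (i, i) * w $ i = \<mu> * w $ i"
        using diagonal_mult_vec_index[OF D dD w that(1)] Dw w that by simp
      thus ?thesis using that \<mu> by (simp add: sel_def)
    qed
    define c where "c = vec l (\<lambda>j. w $ (sel ! j))"
    have c: "c \<in> carrier_vec l" by (simp add: c_def)
    have "X *\<^sub>v c = w"
    proof (rule eq_vecI)
      fix i assume "i < dim_vec w"
      hence i: "i < n" using w by simp
      show "(X *\<^sub>v c) $ i = w $ i"
      proof (cases "i \<in> set sel")
        case True
        then obtain j where "j < l" "i = sel ! j" by (auto simp: in_set_conv_nth l_def)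
        thus ?thesis using Xc[OF c] by (simp add: c_def)
      next
        case False
        hence "row X i = 0\<^sub>v l" using i by (intro eq_vecI) (auto simp: X_def l_def)
        thus ?thesis using mem[OF i] False X c i by auto
      qed
    qed (use X w in auto)
    hence "v = Z *\<^sub>v c" using Pw assoc_mult_mat_vec[OF P X c] by (simp add: Z_def)
    thus ?thesis using c by blast
  qed
  have "eigenvector_matrix G E Z L"
    unfolding eigenvector_matrix_def using G Z L dL GZ rk span nth
    by (auto simp: L_def square_mat.simps)
  moreover have "filter (\<lambda>d. d \<in> E) (diag_mat D) = map (\<lambda>i. D $$ (i, i)) sel"
    unfolding diag_mat_def sel_def filter_map using D by (simp add: o_def)
  hence "dim_row L = length (filter (\<lambda>d. d \<in> E) (diag_mat D))" using L by (simp add: l_def)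
  ultimately show ?thesis by blast
qed

text \<open>The multiplicity is written as the number of columns of an eigenvector matrix for \<open>{\<mu>}\<close>, so that
  symmetries of eigenvector matrices become symmetries of multiplicities.\<close>
lemma order_char_poly_diagonalizable:
  fixes G D :: "complex mat"
  assumes wit: "similar_mat_wit G D P P'" and G: "G \<in> carrier_mat n n" and dD: "diagonal_mat D"
  shows "Polynomial.order \<mu> (char_poly G) = length (filter (\<lambda>d. d \<in> {\<mu>}) (diag_mat D))"
proof -
  have len: "count (mset xs) \<mu> = length (filter (\<lambda>d. d \<in> {\<mu>}) xs)" for xs
    by (induction xs) auto
  have "char_poly G = char_poly D" using wit by (intro char_poly_similar) (auto simp: similar_mat_def)
  thus ?thesis using order_char_poly_diagonal[OF similar_mat_witD2(5)[OF G wit] dD]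
    by (simp add: len)
qed

section \<open>Antilinear symmetries that negate the spectrum\<close>

text \<open>The antilinear map \<open>v \<mapsto> T cnj(v)\<close> is an involution that anticommutes with \<open>G\<close>.\<close>
definition conj_symmetry :: "complex mat \<Rightarrow> complex mat \<Rightarrow> bool" where
  "conj_symmetry T G \<longleftrightarrow> G * T = - (T * cnj_mat G) \<and> T * cnj_mat T = 1\<^sub>m (dim_row G)"

text \<open>The antilinear map anticommutes with \<open>G\<close>, so it negates the (real) eigenvalue; being an involution,
  it is inverted by itself.\<close>
lemma conj_symmetry_eigenvector:
  assumes sym: "conj_symmetry T G" and G: "G \<in> carrier_mat n n" and T: "T \<in> carrier_mat n n"
    and \<mu>: "\<mu> \<in> \<real>" and ev: "eigenvector G v \<mu>"
  shows "eigenvector G (T *\<^sub>v map_vec cnj v) (- \<mu>)"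
    "v = T *\<^sub>v map_vec cnj (T *\<^sub>v map_vec cnj v)"
proof -
  have v: "v \<in> carrier_vec n" "v \<noteq> 0\<^sub>v n" "G *\<^sub>v v = \<mu> \<cdot>\<^sub>v v"
    using ev G by (auto simp: eigenvector_def)
  let ?v = "map_vec cnj v"
  have v': "?v \<in> carrier_vec n" using v by simp
  have GT: "G * T = - (T * cnj_mat G)" and TT: "T * cnj_mat T = 1\<^sub>m n"
    using sym G by (auto simp: conj_symmetry_def)
  have "map_vec cnj (T *\<^sub>v ?v) = cnj_mat T *\<^sub>v v"
    using cnj_mat_mult_vec[OF T v'] by simp
  hence "T *\<^sub>v map_vec cnj (T *\<^sub>v ?v) = (T * cnj_mat T) *\<^sub>v v"
    using T v by (simp add: assoc_mult_mat_vec[of _ n n _ n])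
  thus inv: "v = T *\<^sub>v map_vec cnj (T *\<^sub>v ?v)" using TT v by simp
  have "cnj_mat G *\<^sub>v ?v = \<mu> \<cdot>\<^sub>v ?v"
  proof -
    have "map_vec cnj (\<mu> \<cdot>\<^sub>v v) = \<mu> \<cdot>\<^sub>v ?v"
      using \<mu> by (intro eq_vecI) (auto simp: Reals_cnj_iff)
    thus ?thesis using cnj_mat_mult_vec[OF G v(1)] v(3) by simp
  qed
  hence "T *\<^sub>v (cnj_mat G *\<^sub>v ?v) = \<mu> \<cdot>\<^sub>v (T *\<^sub>v ?v)"
    using mult_mat_vec[OF T v'] by simp
  moreover have "G *\<^sub>v (T *\<^sub>v ?v) = - (T *\<^sub>v (cnj_mat G *\<^sub>v ?v))"
  proof -
    have "G *\<^sub>v (T *\<^sub>v ?v) = (- (T * cnj_mat G)) *\<^sub>v ?v"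
      using assoc_mult_mat_vec[OF G T v'] GT by simp
    also have "\<dots> = - ((T * cnj_mat G) *\<^sub>v ?v)"
      using T G v' by (intro eq_vecI) auto
    also have "(T * cnj_mat G) *\<^sub>v ?v = T *\<^sub>v (cnj_mat G *\<^sub>v ?v)"
      using G by (intro assoc_mult_mat_vec[OF T _ v']) simp
    finally show ?thesis .
  qed
  ultimately have "G *\<^sub>v (T *\<^sub>v ?v) = (- \<mu>) \<cdot>\<^sub>v (T *\<^sub>v ?v)" by (intro eq_vecI) auto
  moreover have "T *\<^sub>v ?v \<noteq> 0\<^sub>v n"
  proof
    assume "T *\<^sub>v ?v = 0\<^sub>v n"
    hence "v = T *\<^sub>v map_vec cnj (0\<^sub>v n)" using inv by simp
    also have "map_vec cnj (0\<^sub>v n) = 0\<^sub>v n" by (intro eq_vecI) auto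
    also have "T *\<^sub>v 0\<^sub>v n = 0\<^sub>v n" using T by (intro eq_vecI) auto
    finally show False using v by simp
  qed
  ultimately show "eigenvector G (T *\<^sub>v ?v) (- \<mu>)"
    using G T v' by (auto simp: eigenvector_def)
qed

text \<open>The antilinear involution of a conjugation symmetry carries a maximal independent family of
  eigenvectors for \<open>E\<close> to one for \<open>- E\<close>. Maximality comes from applying it to an eigenvector for \<open>- E\<close>
  and going back.\<close>
lemma conj_symmetry_eigenvector_matrix:
  assumes sym: "conj_symmetry T G" and G: "G \<in> carrier_mat n n" and T: "T \<in> carrier_mat n n"
    and ev: "eigenvector_matrix G E Z L" and E: "E \<subseteq> \<real>"
  shows "eigenvector_matrix G (uminus ` E) (T * cnj_mat Z) (- L)"
proof -
  define l where "l = dim_row L"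
  have Z: "Z \<in> carrier_mat n l" and L: "L \<in> carrier_mat l l" and dL: "diagonal_mat L"
    and LE: "\<And>i. i < l \<Longrightarrow> L $$ (i, i) \<in> E" and GZ: "G * Z = Z * L" and rk: "full_column_rank Z"
    using ev G by (auto simp: eigenvector_matrix_def l_def square_mat.simps)
  have GT: "G * T = - (T * cnj_mat G)" and TT: "T * cnj_mat T = 1\<^sub>m n"
    using sym G by (auto simp: conj_symmetry_def)
  have T': "cnj_mat T \<in> carrier_mat n n" and Z': "cnj_mat Z \<in> carrier_mat n l" 
    and G': "cnj_mat G \<in> carrier_mat n n" using T Z G by auto
  have TZ: "T * cnj_mat Z \<in> carrier_mat n l" using T Z by simp
  have cL: "cnj_mat L = L"
  proof (rule eq_matI)
    fix i j assume "i < dim_row L" "j < dim_col L"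
    thus "cnj_mat L $$ (i, j) = L $$ (i, j)"
      using LE[of i] E dL L by (cases "i = j") (auto simp: diagonal_mat_def Reals_cnj_iff)
  qed auto
  have "G * (T * cnj_mat Z) = - (T * cnj_mat G) * cnj_mat Z"
    using assoc_mult_mat[OF G T Z'] GT by simp
  also have "\<dots> = - (T * cnj_mat G * cnj_mat Z)" using T G' Z' by simp
  also have "T * cnj_mat G * cnj_mat Z = T * cnj_mat (G * Z)"
    using assoc_mult_mat[OF T G' Z'] cnj_mat_mult[OF G Z] by simp
  also have "cnj_mat (G * Z) = cnj_mat Z * L" using cnj_mat_mult[OF Z L] GZ cL by simp
  also have "- (T * (cnj_mat Z * L)) = T * cnj_mat Z * (- L)"
    unfolding assoc_mult_mat[OF T Z' L, symmetric] using Z L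
    by (intro uminus_mult_right_mat[symmetric]) simp
  finally have 1: "G * (T * cnj_mat Z) = T * cnj_mat Z * (- L)" .
  have 2: "full_column_rank (T * cnj_mat Z)"
    unfolding full_column_rank_iff_injective
  proof (intro ballI impI)
    fix c assume "c \<in> carrier_vec (dim_col (T * cnj_mat Z))"
      and "T * cnj_mat Z *\<^sub>v c = 0\<^sub>v (dim_row (T * cnj_mat Z))"
    hence c: "c \<in> carrier_vec l" and 0: "T * cnj_mat Z *\<^sub>v c = 0\<^sub>v n" using TZ by auto
    have TcT: "cnj_mat T * T = 1\<^sub>m n" using mat_mult_left_right_inverse[OF T T' TT] .
    have "cnj_mat Z *\<^sub>v c = cnj_mat T *\<^sub>v (T * cnj_mat Z *\<^sub>v c)"
      using TcT T T' Z' c assoc_mult_mat_vec[OF T Z' c]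
        assoc_mult_mat_vec[OF T' T, of "cnj_mat Z *\<^sub>v c"] by simp
    also have "\<dots> = 0\<^sub>v n" unfolding 0 using T' by (intro eq_vecI) auto
    finally have "map_vec cnj (cnj_mat Z *\<^sub>v c) = 0\<^sub>v n" by auto
    hence "Z *\<^sub>v map_vec cnj c = 0\<^sub>v n" using cnj_mat_mult_vec[OF Z' c] by simp
    hence "map_vec cnj c = 0\<^sub>v l" using rk Z c by (auto simp: full_column_rank_iff_injective)
    hence "map_vec cnj (map_vec cnj c) = map_vec cnj (0\<^sub>v l)" by simp
    thus "c = 0\<^sub>v (dim_col (T * cnj_mat Z))" using Z by (auto intro!: eq_vecI)
  qed
  have 3: "\<exists>c \<in> carrier_vec l. v = T * cnj_mat Z *\<^sub>v c"
    if \<mu>: "\<mu> \<in> uminus ` E" and ev': "eigenvector G v \<mu>" for \<mu> v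
  proof -
    have "\<mu> \<in> \<real>" "- \<mu> \<in> E" using \<mu> E by auto
    from conj_symmetry_eigenvector[OF sym G T this(1) ev'] this(2)
    obtain c where c: "c \<in> carrier_vec l" "T *\<^sub>v map_vec cnj v = Z *\<^sub>v c"
      using ev Z unfolding eigenvector_matrix_def by (metis carrier_matD(2))
    have "v = T *\<^sub>v map_vec cnj (Z *\<^sub>v c)"
      using conj_symmetry_eigenvector(2)[OF sym G T \<open>\<mu> \<in> \<real>\<close> ev'] c(2) by simp
    also have "\<dots> = T * cnj_mat Z *\<^sub>v map_vec cnj c"
      using cnj_mat_mult_vec[OF Z c(1)] assoc_mult_mat_vec[OF T Z', of "map_vec cnj c"] c(1) by simp
    finally show ?thesis using c(1) by auto
  qed
  show ?thesis
    unfolding eigenvector_matrix_def using G TZ Z L dL LE 1 2 3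
    by (auto simp: diagonal_mat_def square_mat.simps)
qed

text \<open>Transport an eigenvector matrix for \<open>E\<close> to \<open>- E\<close>; its number of columns does not change, and any two
  eigenvector matrices for \<open>- E\<close> have equally many columns.\<close>
lemma conj_symmetry_count:
  assumes sym: "conj_symmetry T G" and G: "G \<in> carrier_mat n n" and T: "T \<in> carrier_mat n n"
    and wit: "similar_mat_wit G D P P'" and dD: "diagonal_mat D" and E: "E \<subseteq> \<real>"
  shows "length (filter (\<lambda>d. d \<in> uminus ` E) (diag_mat D)) = length (filter (\<lambda>d. d \<in> E) (diag_mat D))"
proof -
  obtain Z L where 1: "eigenvector_matrix G E Z L"
    and l: "dim_row L = length (filter (\<lambda>d. d \<in> E) (diag_mat D))"
    using eigenvector_matrix_exists[OF wit G dD] by blast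
  obtain Z' L' where 2: "eigenvector_matrix G (uminus ` E) Z' L'"
    and l': "dim_row L' = length (filter (\<lambda>d. d \<in> uminus ` E) (diag_mat D))"
    using eigenvector_matrix_exists[OF wit G dD] by blast
  have "similar_mat (- L) L'"
    using eigenvector_matrix_unique[OF conj_symmetry_eigenvector_matrix[OF sym G T 1 E] 2 G] .
  then obtain r where "- L \<in> carrier_mat r r" "L' \<in> carrier_mat r r" using similar_matD by blast
  thus ?thesis using l l' by auto
qed

section \<open>Structure of the block matrices\<close>

lemma K_mat_carrier [simp]: "K_mat m \<in> carrier_mat (2 * m) (2 * m)"
  and S_mat_carrier [simp]: "S_mat m \<in> carrier_mat (2 * m) (2 * m)"
  by (simp_all add: K_mat_def S_mat_def mult_2)

lemma H_mat_carrier: 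
  "A \<in> carrier_mat m m \<Longrightarrow> B \<in> carrier_mat m m \<Longrightarrow> H_mat A B \<in> carrier_mat (2 * m) (2 * m)"
  by (simp add: H_mat_def mult_2)

lemma cnj_K_mat [simp]: "cnj_mat (K_mat m) = K_mat m"
  by (rule eq_matI) (auto simp: K_mat_def)

lemma cnj_S_mat [simp]: "cnj_mat (S_mat m) = S_mat m"
  by (rule eq_matI) (auto simp: S_mat_def)

lemma adjoint_K_mat: "mat_adjoint (K_mat m) = K_mat m"
  by (rule eq_matI) (auto simp: mat_adjoint_eq_transpose_cnj K_mat_def)

lemma adjoint_S_mat: "mat_adjoint (S_mat m) = S_mat m"
  by (rule eq_matI) (auto simp: mat_adjoint_eq_transpose_cnj S_mat_def)

lemma K_mat_conjugation:
  assumes "A \<in> carrier_mat m m" "B \<in> carrier_mat m m" "C \<in> carrier_mat m m" "D \<in> carrier_mat m m"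
  shows "K_mat m * four_block_mat A B C D * K_mat m = four_block_mat D C B A"
proof -
  have "K_mat m * four_block_mat A B C D = four_block_mat C D A B"
    unfolding K_mat_def using assms
    by (subst mult_four_block_mat[of _ m m _ m _ m]) auto
  moreover have "four_block_mat C D A B * K_mat m = four_block_mat D C B A"
    unfolding K_mat_def using assms
    by (subst mult_four_block_mat[of _ m m _ m _ m]) auto
  ultimately show ?thesis by simp
qed

lemma K_mat_involution: "K_mat m * K_mat m = 1\<^sub>m (2 * m)"
proof -
  have "K_mat m * K_mat m = four_block_mat (1\<^sub>m m) (0\<^sub>m m m) (0\<^sub>m m m) (1\<^sub>m m)"
    unfolding K_mat_def by (subst mult_four_block_mat[of _ m m _ m _ m]) auto
  also have "\<dots> = 1\<^sub>m (2 * m)" by (rule eq_matI) auto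
  finally show ?thesis .
qed

text \<open>\<open>S\<close> is real; its conjugate is put in the form \<open>K Y K\<close> in which conjugates of compressions are
  computed, and the sign of \<open>Y = - S\<close> is what makes the spectrum symmetric about zero.\<close>
lemma cnj_S_mat_conjugation: "cnj_mat (S_mat m) = K_mat m * (- S_mat m) * K_mat m"
proof -
  have "- S_mat m = four_block_mat (- 1\<^sub>m m) (0\<^sub>m m m) (0\<^sub>m m m) (1\<^sub>m m)"
    unfolding S_mat_def by (rule eq_matI) auto
  thus ?thesis by (simp add: K_mat_conjugation) (simp add: S_mat_def)
qed

lemma cnj_SH_conjugation:
  assumes A: "A \<in> carrier_mat m m" and B: "B \<in> carrier_mat m m"
  shows "cnj_mat (S_mat m * H_mat A B) = K_mat m * (S_mat m * H_mat A B) * K_mat m"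
proof -
  have SH: "S_mat m * H_mat A B = four_block_mat A B (cnj_mat B) (cnj_mat A)"
    unfolding S_mat_def H_mat_def using A B
    by (subst mult_four_block_mat[of _ m m _ m _ m]) auto
  show ?thesis
    unfolding SH using A B by (subst K_mat_conjugation) (auto intro!: eq_matI)
qed

lemma col_append_cols:
  assumes X: "X \<in> carrier_mat n r" and Y: "Y \<in> carrier_mat n s"
  shows "append_cols X Y \<in> carrier_mat n (r + s)"
    and "j < r \<Longrightarrow> col (append_cols X Y) j = col X j"
    and "j < s \<Longrightarrow> col (append_cols X Y) (r + j) = col Y j"
  using assms by (auto simp: append_cols_def nth_append)

text \<open>Conjugation followed by \<open>K\<close> exchanges the two blocks of \<open>W\<close>, as \<open>K\<close> is a real involution; the exchange
  is a multiplication from the right by the smaller copy of \<open>K\<close>.\<close>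
lemma K_cnj_append_cols:
  assumes X: "X \<in> carrier_mat (2 * m) h" and Y: "Y = K_mat m * cnj_mat X"
  shows "K_mat m * cnj_mat (append_cols X Y) = append_cols X Y * K_mat h"
proof (rule mat_col_eqI)
  let ?W = "append_cols X Y"
  have Yc: "Y \<in> carrier_mat (2 * m) h"
    unfolding Y using X by (intro mult_carrier_mat[OF K_mat_carrier]) simp
  note col = col_append_cols[OF X Yc]
  have W: "?W \<in> carrier_mat (2 * m) (h + h)" using col(1) .
  have Kh: "K_mat h \<in> carrier_mat (h + h) (h + h)" using K_mat_carrier[of h] by (simp add: mult_2)
  have KY: "K_mat m * cnj_mat Y = X"
  proof -
    have "cnj_mat Y = K_mat m * X" unfolding Y using X by (simp add: cnj_mat_mult[of _ "2 * m" "2 * m" _ h])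
    hence "K_mat m * cnj_mat Y = (K_mat m * K_mat m) * X"
      using X assoc_mult_mat[OF K_mat_carrier K_mat_carrier X] by simp
    thus ?thesis using X by (simp add: K_mat_involution)
  qed
  have cc: "col (cnj_mat M) j = map_vec cnj (col M j)" if "j < dim_col M" for M :: "complex mat" and j
    using that by (intro eq_vecI) auto
  have L: "col (K_mat m * cnj_mat M) j = K_mat m *\<^sub>v map_vec cnj (col M j)"
    if "M \<in> carrier_mat (2 * m) r" "j < r" for M j r
    using that by (subst col_mult2[of _ "2 * m" "2 * m" _ r]) (auto simp: cc)
  fix j assume "j < dim_col (?W * K_mat h)"
  hence j: "j < h + h" using Kh by simp
  show "col (K_mat m * cnj_mat ?W) j = col (?W * K_mat h) j"
  proof (cases "j < h")
    case True
    have "col (K_mat h) j = unit_vec (h + h) (h + j)"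
      using True by (intro eq_vecI) (auto simp: K_mat_def)
    hence "col (?W * K_mat h) j = col Y j"
      using col_mult2[OF W Kh j] mult_mat_unit_vec[OF W, of "h + j"] True col(3) by simp
    thus ?thesis using L[OF W j] L[OF X True] col(2)[OF True] Y by simp
  next
    case False
    then obtain i where i: "j = h + i" "i < h" using j by (metis add_less_cancel_left le_Suc_ex not_less)
    have "col (K_mat h) j = unit_vec (h + h) i"
      using i by (intro eq_vecI) (auto simp: K_mat_def)
    hence "col (?W * K_mat h) j = col X i"
      using col_mult2[OF W Kh j] mult_mat_unit_vec[OF W, of i] i col(2) by simp
    thus ?thesis using L[OF W j] L[OF Yc i(2)] col(3)[OF i(2)] KY i by simp
  qed
next
  show "dim_row (K_mat m * cnj_mat (append_cols X Y)) = dim_row (append_cols X Y * K_mat h)"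
    using X by (simp add: append_cols_def carrier_matD[OF K_mat_carrier])
  show "dim_col (K_mat m * cnj_mat (append_cols X Y)) = dim_col (append_cols X Y * K_mat h)"
    using X Y by (simp add: append_cols_def carrier_matD[OF K_mat_carrier])
qed

section \<open>Compression to a conjugation-invariant subspace\<close>

text \<open>Conjugating a compression to the range of \<open>Q\<close> amounts to a congruence by \<open>T\<close>, because
  \<open>K\<close> maps the conjugate of \<open>Q\<close> back into that range.\<close>
lemma cnj_compression:
  assumes Q: "Q \<in> carrier_mat n k" and K: "K \<in> carrier_mat n n" "mat_adjoint K = K" "K * K = 1\<^sub>m n"
    and T: "T \<in> carrier_mat k k" and KQ: "K * cnj_mat Q = Q * T"
    and X: "X \<in> carrier_mat n n" and Y: "Y \<in> carrier_mat n n" and XY: "cnj_mat X = K * Y * K"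
  shows "cnj_mat (mat_adjoint Q * X * Q) = mat_adjoint T * (mat_adjoint Q * Y * Q) * T"
proof -
  have Q': "cnj_mat Q \<in> carrier_mat n k" and Qa: "mat_adjoint Q \<in> carrier_mat k n"
    and Ta: "mat_adjoint T \<in> carrier_mat k k" and X': "cnj_mat X \<in> carrier_mat n n"
    using Q T X by (auto simp: mat_adjoint_carrier)
  have KKQ: "K * (K * cnj_mat Q) = cnj_mat Q"
    using assoc_mult_mat[OF K(1) K(1) Q', symmetric] K(3) Q' by simp
  have Q1: "cnj_mat Q = K * Q * T"
    using KKQ KQ assoc_mult_mat[OF K(1) Q T] by simp
  have "cnj_mat (mat_adjoint Q) = mat_adjoint (cnj_mat Q)"
    by (rule eq_matI) (auto simp: mat_adjoint_eq_transpose_cnj)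
  also have "\<dots> = mat_adjoint T * (mat_adjoint Q * K)"
    unfolding Q1 using K Q T
    by (simp add: mat_adjoint_mult[of _ n k _ k] mat_adjoint_mult[of _ n n _ k]
        assoc_mult_mat[OF Ta Qa K(1)])
  finally have Q2: "cnj_mat (mat_adjoint Q) = mat_adjoint T * (mat_adjoint Q * K)" .
  have "cnj_mat (mat_adjoint Q * X * Q) = cnj_mat (mat_adjoint Q) * cnj_mat X * cnj_mat Q"
    using Qa X Q by (simp add: cnj_mat_mult[of _ k n _ k] cnj_mat_mult[of _ n n _ k] cnj_mat_mult[of _ k n _ n]
        assoc_mult_mat[of _ k n _ n _ k])
  also have "\<dots> = mat_adjoint T * (mat_adjoint Q * ((K * K) * (Y * ((K * K) * (Q * T)))))"
    unfolding Q1 Q2 XY using Q T K(1) Y Qa Ta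
    by (simp add: assoc_mult_mat[of _ k k _ n _ n] assoc_mult_mat[of _ k k _ n _ k]
        assoc_mult_mat[of _ k n _ n _ n] assoc_mult_mat[of _ k n _ n _ k]
        assoc_mult_mat[of _ n n _ n _ n] assoc_mult_mat[of _ n n _ n _ k]
        assoc_mult_mat[of _ n n _ k _ k])
  also have "\<dots> = mat_adjoint T * (mat_adjoint Q * Y * Q) * T"
    unfolding K(3) using Q T Y Qa Ta
    by (simp add: assoc_mult_mat[of _ k k _ k _ k] assoc_mult_mat[of _ k n _ k _ k]
        assoc_mult_mat[of _ k n _ n _ k] assoc_mult_mat[of _ n n _ k _ k])
  finally show ?thesis .
qed

text \<open>By the congruences the conjugate of \<open>M = Q\<^sup>* S Q\<close> is \<open>- T\<^sup>* M T\<close> and the conjugate of \<open>N = Q\<^sup>* F Q\<close> is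
  \<open>T\<^sup>* N T\<close>. Conjugating \<open>M G = N\<close> and cancelling \<open>T\<^sup>*\<close> and \<open>M\<close> shows that \<open>G\<close> anticommutes with the
  antilinear map of \<open>T\<close>.\<close>
lemma conj_symmetry_compression:
  assumes Q: "Q \<in> carrier_mat n k" "mat_adjoint Q * Q = 1\<^sub>m k"
    and K: "K \<in> carrier_mat n n" "cnj_mat K = K" "mat_adjoint K = K" "K * K = 1\<^sub>m n"
    and T: "T \<in> carrier_mat k k" and KQ: "K * cnj_mat Q = Q * T"
    and S: "S \<in> carrier_mat n n" "cnj_mat S = K * (- S) * K"
    and F: "F \<in> carrier_mat n n" "cnj_mat F = K * F * K"
    and Mi: "Mi \<in> carrier_mat k k" "Mi * (mat_adjoint Q * S * Q) = 1\<^sub>m k"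
    and G: "G \<in> carrier_mat k k" "(mat_adjoint Q * S * Q) * G = mat_adjoint Q * F * Q"
  shows "conj_symmetry T G"
proof -
  define M where "M = mat_adjoint Q * S * Q"
  define N where "N = mat_adjoint Q * F * Q"
  have Qa: "mat_adjoint Q \<in> carrier_mat k n" using Q by (simp add: mat_adjoint_carrier)
  have M: "M \<in> carrier_mat k k" using Qa S Q by (simp add: M_def)
  have T': "cnj_mat T \<in> carrier_mat k k" and Q': "cnj_mat Q \<in> carrier_mat n k"
    and G': "cnj_mat G \<in> carrier_mat k k" using T Q G by auto
  have "Q * (T * cnj_mat T) = K * (cnj_mat Q * cnj_mat T)"
    using assoc_mult_mat[OF Q(1) T T'] assoc_mult_mat[OF K(1) Q' T'] KQ by simp
  also have "cnj_mat Q * cnj_mat T = cnj_mat (K * cnj_mat Q)"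
    using cnj_mat_mult[OF Q(1) T] KQ by simp
  also have "\<dots> = K * Q" using cnj_mat_mult[OF K(1) Q'] K(2) by simp
  also have "K * (K * Q) = Q" using assoc_mult_mat[OF K(1) K(1) Q(1)] K(4) Q by simp
  finally have QTT: "Q * (T * cnj_mat T) = Q" .
  have "T * cnj_mat T = mat_adjoint Q * (Q * (T * cnj_mat T))"
    using assoc_mult_mat[OF Qa Q(1) mult_carrier_mat[OF T T']] Q(2) T by simp
  hence TT: "T * cnj_mat T = 1\<^sub>m k" unfolding QTT Q(2) .
  have Ta: "mat_adjoint T \<in> carrier_mat k k" "mat_adjoint (cnj_mat T) \<in> carrier_mat k k"
    using T T' by (auto simp: mat_adjoint_carrier)
  have adj1: "mat_adjoint (1\<^sub>m k) = (1\<^sub>m k :: complex mat)"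
    by (rule eq_matI) (auto simp: mat_adjoint_eq_transpose_cnj)
  have Tinv: "mat_adjoint (cnj_mat T) * mat_adjoint T = 1\<^sub>m k"
    using mat_adjoint_mult[OF T T'] TT adj1 by simp
  have "cnj_mat M = mat_adjoint T * (mat_adjoint Q * (- S) * Q) * T"
    unfolding M_def using S by (intro cnj_compression[OF Q(1) K(1,3,4) T KQ]) auto
  also have "mat_adjoint Q * (- S) * Q = - M" using Qa S Q by (simp add: M_def)
  finally have cM: "cnj_mat M = - (mat_adjoint T * M * T)" using Ta M T by simp
  have cN: "cnj_mat N = mat_adjoint T * N * T"
    unfolding N_def using F by (intro cnj_compression[OF Q(1) K(1,3,4) T KQ]) auto
  have MG: "M * G = N" using G by (simp add: M_def N_def)
  have "mat_adjoint T * (M * (- (T * cnj_mat G))) = cnj_mat M * cnj_mat G"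
    unfolding cM using Ta M T G' by (simp add: assoc_mult_mat[of _ k k _ k _ k])
  also have "\<dots> = cnj_mat N" using cnj_mat_mult[OF M G(1)] MG by simp
  also have "\<dots> = mat_adjoint T * (M * (G * T))"
    unfolding cN unfolding MG[symmetric] using Ta M T G by (simp add: assoc_mult_mat[of _ k k _ k _ k])
  finally have eq: "mat_adjoint T * (M * (- (T * cnj_mat G))) = mat_adjoint T * (M * (G * T))" .
  \<comment> \<open>Both \<open>T\<^sup>*\<close> and \<open>M\<close> have left inverses.\<close>
  have cancel: "X = Mi * (mat_adjoint (cnj_mat T) * (mat_adjoint T * (M * X)))"
    if X: "X \<in> carrier_mat k k" for X
  proof -
    have "mat_adjoint (cnj_mat T) * (mat_adjoint T * (M * X)) = M * X"
      using assoc_mult_mat[OF Ta(2) Ta(1) mult_carrier_mat[OF M X]] Tinv M X by simp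
    moreover have "Mi * (M * X) = X"
      using assoc_mult_mat[OF Mi(1) M X] Mi(2) X by (simp add: M_def)
    ultimately show ?thesis by simp
  qed
  have "- (T * cnj_mat G) = G * T"
    using cancel[of "- (T * cnj_mat G)"] cancel[of "G * T"] eq T G G' by simp
  thus ?thesis using TT G by (simp add: conj_symmetry_def)
qed

lemma hermitian_pos_def_compression:
  assumes Q: "Q \<in> carrier_mat n k" "mat_adjoint Q * Q = 1\<^sub>m k"
    and F: "F \<in> carrier_mat n n" "hermitian_pos_def F"
  shows "hermitian_pos_def (mat_adjoint Q * F * Q)"
proof -
  have Qa: "mat_adjoint Q \<in> carrier_mat k n" using Q by (simp add: mat_adjoint_carrier)
  have N: "mat_adjoint Q * F * Q \<in> carrier_mat k k" using Q Qa F by simp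
  have Fh: "mat_adjoint F = F" using F by (simp add: hermitian_pos_def_def)
  have h: "mat_adjoint (mat_adjoint Q * F * Q) = mat_adjoint Q * F * Q"
    using Q Qa F Fh
    by (simp add: mat_adjoint_mult[of _ k n _ k] mat_adjoint_mult[of _ k n _ n]
        mat_adjoint_mult[of _ n n _ k] assoc_mult_mat[OF Qa F(1) Q(1)])
  have pd: "Re ((mat_adjoint Q * F * Q *\<^sub>v v) \<bullet>c v) > 0" if v: "v \<in> carrier_vec k" "v \<noteq> 0\<^sub>v k" for v
  proof -
    have Qv: "Q *\<^sub>v v \<in> carrier_vec n" using Q v by simp
    have "mat_adjoint Q *\<^sub>v (Q *\<^sub>v v) = v" using assoc_mult_mat_vec[OF Qa Q(1) v(1)] Q(2) v by simp
    moreover have "mat_adjoint Q *\<^sub>v 0\<^sub>v n = 0\<^sub>v k" using Qa by (intro eq_vecI) auto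
    ultimately have "Q *\<^sub>v v \<noteq> 0\<^sub>v n" using v by auto
    hence "Re ((F *\<^sub>v (Q *\<^sub>v v)) \<bullet>c (Q *\<^sub>v v)) > 0" using F Qv by (auto simp: hermitian_pos_def_def)
    moreover have "(mat_adjoint Q *\<^sub>v (F *\<^sub>v (Q *\<^sub>v v))) \<bullet>c v = (F *\<^sub>v (Q *\<^sub>v v)) \<bullet>c (Q *\<^sub>v v)"
      using inner_mat_adjoint[OF Qa, of "F *\<^sub>v (Q *\<^sub>v v)" v] F Qv v by simp
    moreover have "mat_adjoint Q * F * Q *\<^sub>v v = mat_adjoint Q *\<^sub>v (F *\<^sub>v (Q *\<^sub>v v))"
      using Qa F Q v Qv assoc_mult_mat_vec[of "mat_adjoint Q * F" k n Q k v]
        assoc_mult_mat_vec[OF Qa F(1) Qv] by simp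
    ultimately show ?thesis by simp
  qed
  show ?thesis unfolding hermitian_pos_def_def using N Qa Q h pd by (auto simp: square_mat.simps)
qed

lemma mat_inverse_of_invertible:
  fixes M :: "complex mat"
  assumes M: "M \<in> carrier_mat k k" "invertible_mat M"
  shows "the (mat_inverse M) \<in> carrier_mat k k" "M * the (mat_inverse M) = 1\<^sub>m k"
    "the (mat_inverse M) * M = 1\<^sub>m k"
proof -
  obtain B where B: "M * B = 1\<^sub>m k" "B * M = 1\<^sub>m (dim_row B)"
    using M unfolding invertible_mat_def inverts_mat_def by auto
  have "dim_col B = k" using arg_cong[OF B(1), of dim_col] by simp
  moreover have "dim_row B = k" using arg_cong[OF B(2), of dim_col] M by simp
  ultimately have Bc: "B \<in> carrier_mat k k" by auto
  have "M \<in> Units (ring_mat TYPE(complex) k ())"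
    using M B Bc unfolding Units_def by (auto simp: ring_mat_def)
  then obtain C where "mat_inverse M = Some C"
    using mat_inverse(1)[OF M(1), of "()"] by (cases "mat_inverse M") auto
  with mat_inverse(2)[OF M(1) this]
  show "the (mat_inverse M) \<in> carrier_mat k k" "M * the (mat_inverse M) = 1\<^sub>m k"
    "the (mat_inverse M) * M = 1\<^sub>m k" by auto
qed

text \<open>The range of \<open>Q\<close> equals that of \<open>W\<close>, so it inherits the invariance under conjugation followed by \<open>K\<close>;
  the change of basis \<open>R\<close> enters \<open>T = R P cnj(R)\<inverse>\<close> once linearly and once conjugated.\<close>
lemma invariant_range_representation:
  assumes K: "K \<in> carrier_mat n n" and W: "W \<in> carrier_mat n k" and P: "P \<in> carrier_mat k k"
    and KW: "K * cnj_mat W = W * P"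
    and Q: "Q \<in> carrier_mat n k" and R: "R \<in> carrier_mat k k" "invertible_mat R" and WQR: "W = Q * R"
  shows "\<exists>T \<in> carrier_mat k k. K * cnj_mat Q = Q * T"
proof -
  define Ri where "Ri = the (mat_inverse R)"
  note Ri = mat_inverse_of_invertible[OF R, folded Ri_def]
  have Ri': "cnj_mat Ri \<in> carrier_mat k k" and Q': "cnj_mat Q \<in> carrier_mat n k"
    and W': "cnj_mat W \<in> carrier_mat n k" using Ri Q W by auto
  have "Q = W * Ri" unfolding WQR using assoc_mult_mat[OF Q R(1) Ri(1)] Ri(2) Q by simp
  hence "K * cnj_mat Q = K * (cnj_mat W * cnj_mat Ri)" using cnj_mat_mult[OF W Ri(1)] by simp
  also have "\<dots> = W * P * cnj_mat Ri" using assoc_mult_mat[OF K W' Ri'] KW by simp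
  also have "\<dots> = Q * (R * P * cnj_mat Ri)"
    unfolding WQR using Q R(1) P Ri'
    by (simp add: assoc_mult_mat[of _ n k _ k _ k] assoc_mult_mat[of _ k k _ k _ k])
  finally show ?thesis using R(1) P Ri' by (intro bexI[of _ "R * P * cnj_mat Ri"]) auto
qed

section \<open>Symmetry of the oblique Rayleigh quotient\<close>

theorem theorem4p5:
  fixes m k :: nat and A B W\<^sub>p W\<^sub>m W Q R G :: "complex mat"
  assumes m: "m \<ge> 1"
    and A: "A \<in> carrier_mat m m" "mat_adjoint A = A"
    and B: "B \<in> carrier_mat m m" "transpose_mat B = B"
    and SH: "hermitian_pos_def (S_mat m * H_mat A B)"
    and k: "even k"
    and Wp: "W\<^sub>p \<in> carrier_mat (2 * m) (k div 2)"
    and Wm: "W\<^sub>m = K_mat m * cnj_mat W\<^sub>p"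
    and W: "W = append_cols W\<^sub>p W\<^sub>m" "full_column_rank W"
    and Q: "Q \<in> carrier_mat (2 * m) k" "mat_adjoint Q * Q = 1\<^sub>m k"
    and R: "R \<in> carrier_mat k k" "invertible_mat R"
    and WQR: "W = Q * R"
    and QSQ: "invertible_mat (mat_adjoint Q * S_mat m * Q)"
    and G: "G = G_mat m A B Q"
  shows
    "spectrum G \<subseteq> \<real>
     \<and> (\<forall>\<mu>. Polynomial.order \<mu> (char_poly G) = Polynomial.order (- \<mu>) (char_poly G))
     \<and> (\<exists>Z\<^sub>p \<Lambda>\<^sub>p. eigenvector_matrix G pos_reals Z\<^sub>p \<Lambda>\<^sub>p)
     \<and> (\<exists>Z\<^sub>m \<Lambda>\<^sub>m. eigenvector_matrix G neg_reals Z\<^sub>m \<Lambda>\<^sub>m)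
     \<and> (\<forall>Z\<^sub>p \<Lambda>\<^sub>p Z\<^sub>m \<Lambda>\<^sub>m.
          eigenvector_matrix G pos_reals Z\<^sub>p \<Lambda>\<^sub>p \<and> eigenvector_matrix G neg_reals Z\<^sub>m \<Lambda>\<^sub>m \<longrightarrow>
          \<Lambda>\<^sub>p \<in> carrier_mat (k div 2) (k div 2) \<and> \<Lambda>\<^sub>m \<in> carrier_mat (k div 2) (k div 2) \<and>
          (\<exists>\<pi>. \<pi> permutes {..<k div 2} \<and>
               (\<forall>i < k div 2. \<Lambda>\<^sub>m $$ (\<pi> i, \<pi> i) = - \<Lambda>\<^sub>p $$ (i, i))))
     \<and> (\<forall>Z\<^sub>p \<Lambda>\<^sub>p. eigenvector_matrix G pos_reals Z\<^sub>p \<Lambda>\<^sub>p \<longrightarrow>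
          (\<exists>Z\<^sub>m. eigenvector_matrix G neg_reals Z\<^sub>m (- \<Lambda>\<^sub>p) \<and>
                Q * Z\<^sub>m = K_mat m * cnj_mat (Q * Z\<^sub>p)))"
proof -
  define h where "h = k div 2"
  have kh: "k = h + h" using k by (auto simp: h_def)
  define S where "S = S_mat m"
  define F where "F = S_mat m * H_mat A B"
  define M where "M = mat_adjoint Q * S * Q"
  define N where "N = mat_adjoint Q * F * Q"
  have H: "H_mat A B \<in> carrier_mat (2 * m) (2 * m)" using H_mat_carrier A(1) B(1) .
  have S: "S \<in> carrier_mat (2 * m) (2 * m)" "mat_adjoint S = S"
    by (simp_all add: S_def adjoint_S_mat)
  have F: "F \<in> carrier_mat (2 * m) (2 * m)"
    unfolding F_def using H by (intro mult_carrier_mat[OF S_mat_carrier])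
  have Qa: "mat_adjoint Q \<in> carrier_mat k (2 * m)" using Q by (simp add: mat_adjoint_carrier)
  have M: "M \<in> carrier_mat k k" using Qa S Q by (simp add: M_def)
  have N: "N \<in> carrier_mat k k" using Qa F Q by (simp add: N_def)
  have Mh: "mat_adjoint M = M"
    unfolding M_def using Qa S Q
    by (simp add: mat_adjoint_mult[of _ k "2 * m" _ k] mat_adjoint_mult[of _ k "2 * m" _ "2 * m"]
        mat_adjoint_mult[of _ "2 * m" "2 * m" _ k] assoc_mult_mat[OF Qa S(1) Q(1)])
  have Npd: "hermitian_pos_def N"
    unfolding N_def using hermitian_pos_def_compression[OF Q F] SH by (simp add: F_def)
  define Mi where "Mi = the (mat_inverse M)"
  have Mi: "Mi \<in> carrier_mat k k" "M * Mi = 1\<^sub>m k" "Mi * M = 1\<^sub>m k"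
    using mat_inverse_of_invertible[OF M] QSQ by (auto simp: Mi_def M_def S_def)
  have "mat_adjoint Q * S_mat m * H_mat A B * Q = N"
    unfolding N_def F_def using assoc_mult_mat[OF Qa S_mat_carrier H] by simp
  hence GMi: "G = Mi * N" by (simp add: G G_mat_def Mi_def M_def S_def)
  have Gc: "G \<in> carrier_mat k k" using Mi N by (simp add: GMi)
  have MG: "M * G = N" unfolding GMi using assoc_mult_mat[OF M Mi(1) N] Mi(2) N by simp

  have Wc: "W \<in> carrier_mat (2 * m) k" using WQR Q R by simp
  have Wp': "W\<^sub>p \<in> carrier_mat (2 * m) h" using Wp by (simp add: h_def)
  have Kh: "K_mat h \<in> carrier_mat k k" using K_mat_carrier[of h] by (simp add: kh mult_2)
  have "K_mat m * cnj_mat W = W * K_mat h" unfolding W(1) using K_cnj_append_cols[OF Wp' Wm] .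
  from invariant_range_representation[OF K_mat_carrier Wc Kh this Q(1) R WQR]
  obtain T where T: "T \<in> carrier_mat k k" and KQ: "K_mat m * cnj_mat Q = Q * T" by blast
  have sym: "conj_symmetry T G"
  proof (rule conj_symmetry_compression[OF Q K_mat_carrier cnj_K_mat adjoint_K_mat
        K_mat_involution T KQ S(1) _ F])
    show "cnj_mat S = K_mat m * - S * K_mat m" unfolding S_def by (rule cnj_S_mat_conjugation)
    show "cnj_mat F = K_mat m * F * K_mat m" unfolding F_def by (rule cnj_SH_conjugation[OF A(1) B(1)])
  qed (use Mi MG Gc in \<open>auto simp: M_def N_def\<close>)

  obtain D P P' where dD: "diagonal_mat D" and wit: "similar_mat_wit G D P P'"
    using pencil_diagonalizable[OF M Mh N Npd Gc MG] by blast
  let ?d = "diag_mat D" and ?n = "\<lambda>E. length (filter (\<lambda>d. d \<in> E) (diag_mat D))"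
  have ord: "Polynomial.order \<mu> (char_poly G) = ?n {\<mu>}" for \<mu>
    using order_char_poly_diagonalizable[OF wit Gc dD] .
  have spec: "\<mu> \<in> \<real>" "\<mu> \<noteq> 0" if "\<mu> \<in> spectrum G" for \<mu>
    using that pencil_eigenvalue_real[OF M Mh N Npd Gc MG]
    by (auto simp: spectrum_def eigenvalue_def)
  have diag_spec: "d \<in> spectrum G" if "d \<in> set ?d" for d
  proof -
    have "Polynomial.order d (char_poly G) \<noteq> 0"
      using that unfolding ord by (auto simp: filter_empty_conv)
    hence "poly (char_poly G) d = 0" by (metis order_0I)
    thus ?thesis using eigenvalue_root_char_poly[OF Gc] by (simp add: spectrum_def)
  qed
  have symE: "?n (uminus ` E) = ?n E" if "E \<subseteq> \<real>" for E
    using conj_symmetry_count[OF sym Gc T wit dD that] .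

  have 1: "spectrum G \<subseteq> \<real>" using spec by blast
  \<comment> \<open>The diagonal of \<open>D\<close> consists of real numbers, so off the real line both orders vanish.\<close>
  have 2: "Polynomial.order \<mu> (char_poly G) = Polynomial.order (- \<mu>) (char_poly G)" for \<mu>
  proof (cases "\<mu> \<in> \<real>")
    case True
    thus ?thesis using symE[of "{\<mu>}"] by (simp add: ord)
  next
    case False
    hence "\<mu> \<notin> set ?d" "- \<mu> \<notin> set ?d" using diag_spec spec by (auto, metis Reals_minus_iff)
    moreover have "filter (\<lambda>d. d \<in> {a}) ?d = []" if "a \<notin> set ?d" for a
      using that by (auto simp: filter_empty_conv)
    ultimately show ?thesis unfolding ord by metis
  qed
  have pos_real: "pos_reals \<subseteq> \<real>" and neg_pos: "neg_reals = uminus ` pos_reals"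
    by (auto simp: pos_reals_def neg_reals_def image_iff)
      (metis minus_minus neg_0_less_iff_less of_real_minus greaterThan_iff)
  \<comment> \<open>The \<open>k\<close> diagonal entries are real and nonzero, and the symmetry pairs the positive ones
    with the negative ones, so each sign occurs exactly \<open>k div 2\<close> times.\<close>
  have "?n pos_reals = h"
  proof -
    have "filter (\<lambda>d. d \<in> neg_reals) ?d = filter (\<lambda>d. d \<notin> pos_reals) ?d"
    proof (rule filter_cong[OF refl])
      fix d assume "d \<in> set ?d"
      hence "d \<in> \<real>" "d \<noteq> 0" using diag_spec spec by auto
      then obtain x where "d = of_real x" "x \<noteq> 0" by (auto elim: Reals_cases)
      thus "(d \<in> neg_reals) = (d \<notin> pos_reals)"
        by (auto simp: pos_reals_def neg_reals_def image_iff)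
    qed
    hence "?n pos_reals + ?n neg_reals = length ?d" by (simp add: sum_length_filter_compl)
    also have "\<dots> = k" using similar_mat_witD2(5)[OF Gc wit] by (simp add: diag_mat_def)
    finally show ?thesis using symE[OF pos_real] neg_pos kh by simp
  qed
  have flip: "eigenvector_matrix G neg_reals (T * cnj_mat Z) (- L)"
    if "eigenvector_matrix G pos_reals Z L" for Z L
    using conj_symmetry_eigenvector_matrix[OF sym Gc T that pos_real] unfolding neg_pos .
  obtain Z\<^sub>0 L\<^sub>0 where ex_pos: "eigenvector_matrix G pos_reals Z\<^sub>0 L\<^sub>0" and "dim_row L\<^sub>0 = h"
    using eigenvector_matrix_exists[OF wit Gc dD, of pos_reals] \<open>?n pos_reals = h\<close> by auto
  have dims: "L \<in> carrier_mat h h" if "eigenvector_matrix G pos_reals Z L" for Z L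
    using similar_matD[OF eigenvector_matrix_unique[OF ex_pos that Gc]] \<open>dim_row L\<^sub>0 = h\<close> by auto
  have 5: "\<Lambda>\<^sub>p \<in> carrier_mat h h \<and> \<Lambda>\<^sub>m \<in> carrier_mat h h \<and>
      (\<exists>\<pi>. \<pi> permutes {..<h} \<and> (\<forall>i<h. \<Lambda>\<^sub>m $$ (\<pi> i, \<pi> i) = - \<Lambda>\<^sub>p $$ (i, i)))"
    if p: "eigenvector_matrix G pos_reals Z\<^sub>p \<Lambda>\<^sub>p" and n: "eigenvector_matrix G neg_reals Z\<^sub>m \<Lambda>\<^sub>m"
    for Z\<^sub>p \<Lambda>\<^sub>p Z\<^sub>m \<Lambda>\<^sub>m
  proof -
    have Lp: "\<Lambda>\<^sub>p \<in> carrier_mat h h" using dims[OF p] .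
    have sim: "similar_mat (- \<Lambda>\<^sub>p) \<Lambda>\<^sub>m" using eigenvector_matrix_unique[OF flip[OF p] n Gc] .
    hence Lm: "\<Lambda>\<^sub>m \<in> carrier_mat h h" using similar_matD[OF sim] Lp by auto
    have "mset (diag_mat (- \<Lambda>\<^sub>p)) = mset (diag_mat \<Lambda>\<^sub>m)"
      using flip[OF p] n by (intro similar_diagonal_mset[OF sim]) (auto simp: eigenvector_matrix_def)
    then obtain \<pi> where \<pi>: "\<pi> permutes {..<length (diag_mat \<Lambda>\<^sub>m)}"
      and eq: "permute_list \<pi> (diag_mat \<Lambda>\<^sub>m) = diag_mat (- \<Lambda>\<^sub>p)"
      by (rule mset_eq_permutation)
    have len: "length (diag_mat \<Lambda>\<^sub>m) = h" using Lm by (simp add: diag_mat_def)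
    have "\<Lambda>\<^sub>m $$ (\<pi> i, \<pi> i) = - \<Lambda>\<^sub>p $$ (i, i)" if i: "i < h" for i
    proof -
      have "\<pi> i < h" using permutes_in_image[OF \<pi>, of i] i len by simp
      hence "\<Lambda>\<^sub>m $$ (\<pi> i, \<pi> i) = permute_list \<pi> (diag_mat \<Lambda>\<^sub>m) ! i"
        using permute_list_nth[OF \<pi>, of i] i len Lm by (simp add: diag_mat_def)
      thus ?thesis unfolding eq using i Lp by (simp add: diag_mat_def)
    qed
    thus ?thesis using Lp Lm \<pi> len by auto
  qed
  have 6: "Q * (T * cnj_mat Z) = K_mat m * cnj_mat (Q * Z)"
    if "eigenvector_matrix G pos_reals Z L" for Z L
  proof -
    have Z: "Z \<in> carrier_mat k (dim_row L)" using that Gc by (simp add: eigenvector_matrix_def)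
    have Z': "cnj_mat Z \<in> carrier_mat k (dim_row L)" and Q': "cnj_mat Q \<in> carrier_mat (2 * m) k"
      using Z Q by auto
    show ?thesis
      using assoc_mult_mat[OF Q(1) T Z'] assoc_mult_mat[OF K_mat_carrier Q' Z'] KQ
        cnj_mat_mult[OF Q(1) Z] by simp
  qed
  show ?thesis
    unfolding h_def[symmetric] using 1 2 ex_pos flip 5 6 by blast
qed

end
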